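(* Let $\varphi(z)=1+B_1z+B_2z^2+B_3z^3+B_4z^4+\cdots$ be as in the context, and suppose its coefficients satisfy all of the following four conditions: (C1) $\lvert B_1^3-2B_1B_2+2B_2^2\rvert<\lvert 2B_1^2-B_1^3-2B_1B_2\rvert$; (C2) $\lvert B_1^3-B_1^2B_2+3B_2^2-3B_1B_3\rvert<3\lvert B_1^3-B_1^2+B_2^2\rvert$; (C3) $\big\lvert B_1^7-B_1^6(8B_2+3)-6B_1^4\big(B_2(3B_2+2B_3+2)-6B_3+9B_4\big)+B_1^5\big(7B_2(B_2+4)-24B_3+18B_4\big)+6B_1^3\big(B_2^3-2B_2^2+8B_2B_3-3B_3^2+6(B_2+1)B_4\big)-6B_1B_2\big(3B_2^3-6B_3^2+B_2^2(4B_3-6)+6B_2(B_4-2B_3)\big)+18B_2^2\big(-2B_3^2+B_2((B_2-2)B_2+2B_4)\big)+B_1^2B_2\big(B_2(B_2(5B_2+6)-24B_3+18B_4)-36(2B_3+B_4)\big)\big\rvert<2\big\lvert\big((B_1-2)B_1+2B_2\big)\big(B_1(2B_1+B_2-3)+3B_3\big)\big(4B_1^3+6B_2^2-B_1^2(B_2+3)-3B_1B_3\big)\big\rvert$; (C4) $0<\dfrac{2B_1-B_1^2-2B_2}{2(B_1-B_2)}<1$. If $f(z)=z+a_2z^2+a_3z^3+\cdots\in\mathcal{S}^*_s(\varphi)$, then $$\lvert a_5\rvert\le\frac{B_1}{4}.$$ The bound is sharp, i.e. equality holds for some $f\in\mathcal{S}^*_s(\varphi)$.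
   Context: $\mathbb{D}$ is the open unit disk in $\mathbb{C}$, and $\mathcal{A}$ is the class of holomorphic functions $f$ on $\mathbb{D}$ with $f(0)=f'(0)-1=0$. The function $\varphi$ is analytic and univalent in $\mathbb{D}$ with $\varphi(0)=1$, $\operatorname{Re}\varphi(z)>0$ on $\mathbb{D}$, $\varphi(\mathbb{D})$ starlike with respect to $\varphi(0)=1$ and symmetric with respect to the real axis, and $\varphi(z)=1+B_1z+B_2z^2+\cdots$ with $B_1>0$ (so all $B_n$ are real). The symbol $\prec$ denotes subordination: $g\prec\varphi$ means $g=\varphi\circ\omega$ for some analytic $\omega:\mathbb{D}\to\mathbb{D}$ with $\omega(0)=0$. The class $\mathcal{S}^*_s(\varphi)$ consists of all $f\in\mathcal{A}$ such that $\dfrac{2zf'(z)}{f(z)-f(-z)}\prec\varphi(z)$ (the quotient being given the value $1$ at $z=0$). *)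

theory Defs
  imports "HOL-Complex_Analysis.Complex_Analysis"
begin

abbreviation unit_disk :: "complex set" where
  "unit_disk \<equiv> ball 0 1"

definition class_A :: "(complex \<Rightarrow> complex) set" where
  "class_A = {f. f holomorphic_on unit_disk \<and> f 0 = 0 \<and> deriv f 0 = 1}"

definition subordinate :: "(complex \<Rightarrow> complex) \<Rightarrow> (complex \<Rightarrow> complex) \<Rightarrow> bool" where
  "subordinate g \<phi> \<longleftrightarrow>
     (\<exists>\<omega>. \<omega> holomorphic_on unit_disk \<and> \<omega> ` unit_disk \<subseteq> unit_disk \<and> \<omega> 0 = 0 \<and>
          (\<forall>z\<in>unit_disk. g z = \<phi> (\<omega> z)))"

text \<open>The library's starlikeness leaves the centre existentially quantified; here the centre is 1.
  The normalisation \<open>\<phi>'(0) > 0\<close> is not included: it is stated on the coefficients where this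
  predicate is used.\<close>

definition ma_minda :: "(complex \<Rightarrow> complex) \<Rightarrow> bool" where
  "ma_minda \<phi> \<longleftrightarrow>
     \<phi> holomorphic_on unit_disk \<and> inj_on \<phi> unit_disk \<and> \<phi> 0 = 1 \<and>
     (\<forall>z\<in>unit_disk. Re (\<phi> z) > 0) \<and>
     (\<forall>w\<in>\<phi> ` unit_disk. closed_segment 1 w \<subseteq> \<phi> ` unit_disk) \<and>
     cnj ` (\<phi> ` unit_disk) = \<phi> ` unit_disk"

text \<open>If \<open>f z = f (- z)\<close> for some \<open>z \<noteq> 0\<close> in the disk, the quotient below is 0 by the convention
  \<open>x / 0 = 0\<close>. Since \<open>Re \<phi> > 0\<close>, the value 0 is not attained by \<open>\<phi>\<close>, so such an \<open>f\<close> is not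
  a member of the class. It would not be one under the meromorphic reading of the quotient either:
  at a zero of \<open>h z = (f z - f (- z)) / 2\<close> of order \<open>m\<close>, finiteness of \<open>z f'(z) / h z\<close> at both \<open>z\<close>
  and \<open>- z\<close> would force \<open>h' z = (f' z + f' (- z)) / 2\<close> to vanish to order at least \<open>m\<close>.\<close>

definition starlike_symmetric :: "(complex \<Rightarrow> complex) \<Rightarrow> (complex \<Rightarrow> complex) set" where
  "starlike_symmetric \<phi> =
     {f \<in> class_A.
        subordinate (\<lambda>z. if z = 0 then 1 else 2 * z * deriv f z / (f z - f (- z))) \<phi>}"

definition cond_C1 :: "real \<Rightarrow> real \<Rightarrow> bool" where
  "cond_C1 B1 B2 \<longleftrightarrow>
     \<bar>B1^3 - 2*B1*B2 + 2*B2^2\<bar> < \<bar>2*B1^2 - B1^3 - 2*B1*B2\<bar>"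

definition cond_C2 :: "real \<Rightarrow> real \<Rightarrow> real \<Rightarrow> bool" where
  "cond_C2 B1 B2 B3 \<longleftrightarrow>
     \<bar>B1^3 - B1^2*B2 + 3*B2^2 - 3*B1*B3\<bar> < 3 * \<bar>B1^3 - B1^2 + B2^2\<bar>"

definition cond_C3 :: "real \<Rightarrow> real \<Rightarrow> real \<Rightarrow> real \<Rightarrow> bool" where
  "cond_C3 B1 B2 B3 B4 \<longleftrightarrow>
     \<bar>B1^7 - B1^6*(8*B2 + 3)
       - 6*B1^4*(B2*(3*B2 + 2*B3 + 2) - 6*B3 + 9*B4)
       + B1^5*(7*B2*(B2 + 4) - 24*B3 + 18*B4)
       + 6*B1^3*(B2^3 - 2*B2^2 + 8*B2*B3 - 3*B3^2 + 6*(B2 + 1)*B4)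
       - 6*B1*B2*(3*B2^3 - 6*B3^2 + B2^2*(4*B3 - 6) + 6*B2*(B4 - 2*B3))
       + 18*B2^2*(- 2*B3^2 + B2*((B2 - 2)*B2 + 2*B4))
       + B1^2*B2*(B2*(B2*(5*B2 + 6) - 24*B3 + 18*B4) - 36*(2*B3 + B4))\<bar>
     < 2 * \<bar>((B1 - 2)*B1 + 2*B2) * (B1*(2*B1 + B2 - 3) + 3*B3)
             * (4*B1^3 + 6*B2^2 - B1^2*(B2 + 3) - 3*B1*B3)\<bar>"

definition cond_C4 :: "real \<Rightarrow> real \<Rightarrow> bool" where
  "cond_C4 B1 B2 \<longleftrightarrow>
     0 < (2*B1 - B1^2 - 2*B2) / (2*(B1 - B2)) \<and> (2*B1 - B1^2 - 2*B2) / (2*(B1 - B2)) < 1"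

end

theory Submission imports Defs begin

text \<open>
  Let \<open>2 z f'(z) = (f z - f (- z)) \<phi> (w z)\<close> with a Schwarz function \<open>w z = w\<^sub>1 z + w\<^sub>2 z\<^sup>2 + \<dots>\<close>. Comparing
  coefficients (\<open>fifth_coefficient_formula\<close>) gives \<open>4 a\<^sub>5 = B\<^sub>1 \<Lambda>(w)\<close> with
  \<open>\<Lambda>(w) = w\<^sub>4 + 2 \<mu> w\<^sub>1 w\<^sub>3 + \<nu> w\<^sub>2\<^sup>2 + \<rho> w\<^sub>1\<^sup>2 w\<^sub>2 + \<sigma> w\<^sub>1\<^sup>4\<close>, where
  \<open>\<mu> = B\<^sub>2 / B\<^sub>1\<close>, \<open>\<nu> = B\<^sub>2 / B\<^sub>1 + B\<^sub>1 / 2\<close>, \<open>\<rho> = 3 B\<^sub>3 / B\<^sub>1 + B\<^sub>2\<close> and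
  \<open>\<sigma> = B\<^sub>4 / B\<^sub>1 + B\<^sub>2\<^sup>2 / (2 B\<^sub>1)\<close>. The bound is therefore \<open>\<bar>\<Lambda>(w)\<bar> \<le> 1\<close>, and it is
  attained for \<open>w z = z\<^sup>4\<close>, which belongs to an explicit odd function (\<open>extremal_function\<close>).

  To bound \<open>\<Lambda>\<close>, pass to the Caratheodory function \<open>p = (1 + w) / (1 - w)\<close>. For a Caratheodory function
  \<open>q = 1 + g\<close> and unimodular \<open>\<zeta>\<close>, put \<open>\<kappa> = (1 - \<zeta>) / 2\<close>. Then
  \<open>1 + \<zeta> g / (1 + \<kappa> g)\<close> is again a Caratheodory function, which bounds the coefficient of \<open>z\<^sup>4\<close> in
  \<open>g - \<kappa> g\<^sup>2 + \<kappa>\<^sup>2 g\<^sup>3 - \<kappa>\<^sup>3 g\<^sup>4\<close> by \<open>2\<close> (\<open>caratheodory_moebius_coeff_4\<close>). Averaging over \<open>\<zeta>\<close>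
  replaces the powers of \<open>\<kappa>\<close> by the moments of a measure, that is, by three parameters subject to the
  conditions for a truncated moment problem (\<open>caratheodory_moment_bound\<close>, \<open>two_point_quadrature\<close>).
  A fourth parameter comes from taking as \<open>q\<close> a weighted average of the rotations of \<open>p\<close>
  (\<open>caratheodory_rotation_average\<close>). These four parameters represent \<open>\<Lambda>\<close>
  (\<open>caratheodory_quartic_bound\<close>), and the hypotheses on the coefficients of \<open>\<phi>\<close> make the required
  weights nonnegative and the required moments admissible (\<open>coefficient_conditions\<close>).
\<close>

section \<open>Taylor coefficients on the unit disk\<close>

lemma fps_mult_coeffs:
  fixes F G :: "complex fps"
  shows "fps_nth (F * G) 1 = fps_nth F 0 * fps_nth G 1 + fps_nth F 1 * fps_nth G 0"
    and "fps_nth (F * G) 2 = fps_nth F 0 * fps_nth G 2 + fps_nth F 1 * fps_nth G 1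
           + fps_nth F 2 * fps_nth G 0"
    and "fps_nth (F * G) 3 = fps_nth F 0 * fps_nth G 3 + fps_nth F 1 * fps_nth G 2
           + fps_nth F 2 * fps_nth G 1 + fps_nth F 3 * fps_nth G 0"
    and "fps_nth (F * G) 4 = fps_nth F 0 * fps_nth G 4 + fps_nth F 1 * fps_nth G 3
           + fps_nth F 2 * fps_nth G 2 + fps_nth F 3 * fps_nth G 1 + fps_nth F 4 * fps_nth G 0"
    and "fps_nth (F * G) 5 = fps_nth F 0 * fps_nth G 5 + fps_nth F 1 * fps_nth G 4
           + fps_nth F 2 * fps_nth G 3 + fps_nth F 3 * fps_nth G 2 + fps_nth F 4 * fps_nth G 1
           + fps_nth F 5 * fps_nth G 0"
  by (simp_all add: fps_mult_nth numeral_eq_Suc algebra_simps)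

lemma fps_compose_coeffs:
  fixes F G :: "complex fps"
  assumes "fps_nth G 0 = 0"
  shows "fps_nth (F oo G) 2 = fps_nth F 1 * fps_nth G 2 + fps_nth F 2 * (fps_nth G 1)\<^sup>2"
    and "fps_nth (F oo G) 4 = fps_nth F 1 * fps_nth G 4
           + fps_nth F 2 * (2 * fps_nth G 1 * fps_nth G 3 + (fps_nth G 2)\<^sup>2)
           + fps_nth F 3 * (3 * (fps_nth G 1)\<^sup>2 * fps_nth G 2) + fps_nth F 4 * fps_nth G 1 ^ 4"
proof -
  have s2: "{0..2::nat} = {0, 1, 2}" and s4: "{0..4::nat} = {0, 1, 2, 3, 4}" by auto
  have p: "G ^ 2 = G * G" "G ^ 3 = G * (G * G)" "G ^ 4 = G * (G * (G * G))"
    by (simp_all add: eval_nat_numeral)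
  show "fps_nth (F oo G) 2 = fps_nth F 1 * fps_nth G 2 + fps_nth F 2 * (fps_nth G 1)\<^sup>2"
    using assms unfolding fps_compose_nth s2
    by (simp add: p fps_mult_coeffs power2_eq_square)
  show "fps_nth (F oo G) 4 = fps_nth F 1 * fps_nth G 4
           + fps_nth F 2 * (2 * fps_nth G 1 * fps_nth G 3 + (fps_nth G 2)\<^sup>2)
           + fps_nth F 3 * (3 * (fps_nth G 1)\<^sup>2 * fps_nth G 2) + fps_nth F 4 * fps_nth G 1 ^ 4"
    using assms unfolding fps_compose_nth s4
    by (simp add: p fps_mult_coeffs algebra_simps power2_eq_square power4_eq_xxxx)
qed

lemma disk_fps:
  "f holomorphic_on unit_disk \<Longrightarrow> f has_fps_expansion fps_expansion f 0"
  by (rule has_fps_expansion_fps_expansion[of unit_disk]) auto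

lemma disk_fps_eqI:
  assumes "f holomorphic_on unit_disk" "g has_fps_expansion G"
    and "\<And>z. z \<in> unit_disk \<Longrightarrow> f z = g z"
  shows "fps_expansion f 0 = G"
proof -
  have "\<forall>\<^sub>F z in nhds 0. z \<in> unit_disk"
    by (rule eventually_nhds_in_open) auto
  then have "\<forall>\<^sub>F z in nhds 0. f z = g z"
    by eventually_elim (use assms(3) in auto)
  then have "f has_fps_expansion G"
    using assms(2) has_fps_expansion_cong by blast
  then show ?thesis
    by (rule fps_expansion_eqI)
qed

lemma fps_expansion_nth_0 [simp]: "fps_nth (fps_expansion f 0) 0 = f 0"
  by (simp add: fps_expansion_def)

text \<open>Cauchy's estimate on circles of radius \<open>r < 1\<close>, followed by \<open>r \<rightarrow> 1\<close>.\<close>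

lemma bounded_coeff_le_1:
  assumes hol: "w holomorphic_on unit_disk" and bd: "\<And>z. z \<in> unit_disk \<Longrightarrow> cmod (w z) \<le> 1"
  shows "cmod (fps_nth (fps_expansion w 0) n) \<le> 1"
proof -
  define c where "c = cmod (fps_nth (fps_expansion w 0) n)"
  have est: "c * r ^ n \<le> 1" if "0 < r" "r < 1" for r :: real
  proof -
    have sub: "cball 0 r \<subseteq> unit_disk" "ball 0 r \<subseteq> unit_disk"
      using that by auto
    have "cmod ((deriv ^^ n) w 0) \<le> fact n * 1 / r ^ n"
    proof (rule Cauchy_inequality)
      show "w holomorphic_on ball 0 r" using hol sub holomorphic_on_subset by blast
      show "continuous_on (cball 0 r) w"
        using hol sub holomorphic_on_imp_continuous_on holomorphic_on_subset by blast
    qed (use that bd in auto)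
    then show ?thesis
      using that by (simp add: c_def fps_expansion_def norm_divide field_simps)
  qed
  have "((\<lambda>r. c * r ^ n) \<longlongrightarrow> c * 1 ^ n) (at_left 1)"
    by (intro tendsto_intros)
  moreover have "\<forall>\<^sub>F r in at_left (1::real). c * r ^ n \<le> 1"
    by (rule eventually_mono[OF eventually_at_left_real[of 0 1]]) (use est in auto)
  ultimately show ?thesis
    unfolding c_def[symmetric] using tendsto_upperbound[of "\<lambda>r. c * r ^ n" _ "at_left 1" 1] by simp
qed

lemma has_fps_expansion_rotate:
  fixes f :: "complex \<Rightarrow> complex"
  assumes "f has_fps_expansion F"
  shows "(\<lambda>z. f (c * z)) has_fps_expansion (F oo (fps_const c * fps_X))"
  using has_fps_expansion_compose[OF assms, of "\<lambda>z. c * z" "fps_const c * fps_X"]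
  by (simp add: o_def has_fps_expansion_cmult_left has_fps_expansion_fps_X)

section \<open>Caratheodory functions\<close>

definition caratheodory :: "(complex \<Rightarrow> complex) \<Rightarrow> bool" where
  "caratheodory p \<longleftrightarrow>
     p holomorphic_on unit_disk \<and> p 0 = 1 \<and> (\<forall>z\<in>unit_disk. Re (p z) > 0)"

lemma caratheodory_plus_1_nonzero:
  assumes "caratheodory p" "z \<in> unit_disk"
  shows "p z + 1 \<noteq> 0"
proof
  assume "p z + 1 = 0"
  then have "Re (p z) = -1" by (metis add_eq_0_iff2 one_complex.sel(1) uminus_complex.sel(1))
  moreover have "Re (p z) > 0" using assms by (simp add: caratheodory_def)
  ultimately show False by simp
qed

text \<open>The right half-plane is the set of points nearer to \<open>1\<close> than to \<open>- 1\<close>. Functions with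
  positive real part and functions of modulus below \<open>1\<close> are exchanged through this inequality.\<close>

lemma cmod_minus_1_less_plus_1:
  "cmod (w - 1) < cmod (w + 1) \<longleftrightarrow> Re w > 0"
proof -
  have "cmod (w - 1) < cmod (w + 1) \<longleftrightarrow> (cmod (w - 1))\<^sup>2 < (cmod (w + 1))\<^sup>2"
    using power_less_imp_less_base power_strict_mono by (metis norm_ge_zero pos2)
  also have "\<dots> \<longleftrightarrow> Re w > 0"
    unfolding cmod_power2 by (simp add: power2_eq_square algebra_simps)
  finally show ?thesis .
qed

text \<open>The average of the four rotations \<open>p (\<i>\<^sup>j z)\<close>, with nonnegative weights of sum \<open>1\<close>, is again a
  Caratheodory function, and its coefficients are those of \<open>p\<close> multiplied by the discrete Fourier
  transform of the weights. The weights \<open>(1 + x)\<^sup>2 / 4\<close>, \<open>(1 - x\<^sup>2) / 4\<close>, \<open>(1 - x)\<^sup>2 / 4\<close>,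
  \<open>(1 - x\<^sup>2) / 4\<close> have the transform \<open>1\<close>, \<open>x\<close>, \<open>x\<^sup>2\<close>, \<open>x\<close>. The choice \<open>x = 0\<close> isolates the
  coefficients whose index is divisible by \<open>4\<close>; a general \<open>x\<close> rescales the coefficients of index
  \<open>1\<close>, \<open>2\<close>, \<open>3\<close> while the one of index \<open>4\<close> keeps its full weight.\<close>

lemma caratheodory_rotation_average:
  fixes x :: real
  assumes p: "caratheodory p" and x: "0 \<le> x" "x \<le> 1"
  obtains q where "caratheodory q"
    "fps_nth (fps_expansion q 0) 1 = x * fps_nth (fps_expansion p 0) 1"
    "fps_nth (fps_expansion q 0) 2 = x\<^sup>2 * fps_nth (fps_expansion p 0) 2"
    "fps_nth (fps_expansion q 0) 3 = x * fps_nth (fps_expansion p 0) 3"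
    "fps_nth (fps_expansion q 0) 4 = fps_nth (fps_expansion p 0) 4"
proof -
  define u v w :: real where "u = (1 + x)\<^sup>2 / 4" and "v = (1 - x\<^sup>2) / 4" and "w = (1 - x)\<^sup>2 / 4"
  have uvw: "u > 0" "v \<ge> 0" "w \<ge> 0"
    using x by (auto simp: u_def v_def w_def abs_square_le_1)
  define P where "P = fps_expansion p 0"
  define q where "q = (\<lambda>z. u * p z + v * p (\<i> * z) + w * p (- 1 * z) + v * p (- \<i> * z))"
  have holp: "p holomorphic_on unit_disk" and p0: "p 0 = 1"
    and pos: "\<And>z. z \<in> unit_disk \<Longrightarrow> Re (p z) > 0"
    using p by (auto simp: caratheodory_def)
  have rot: "(\<lambda>z. p (c * z)) holomorphic_on unit_disk" if "cmod c = 1" for c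
    by (rule holomorphic_on_compose_gen[OF _ holp, unfolded o_def])
       (use that in \<open>auto intro!: holomorphic_intros simp: norm_mult\<close>)
  have rot_fps: "(\<lambda>z. p (c * z)) has_fps_expansion (P oo (fps_const c * fps_X))" for c
    unfolding P_def by (intro has_fps_expansion_rotate disk_fps holp)
  have holq: "q holomorphic_on unit_disk"
    unfolding q_def using holp
    by (intro holomorphic_intros rot) auto
  have "caratheodory q"
    unfolding caratheodory_def
  proof (intro conjI ballI)
    show "q 0 = 1"
      unfolding q_def using p0
      by (simp add: u_def v_def w_def power2_eq_square complex_eq_iff field_simps)
    fix z :: complex assume "z \<in> unit_disk"
    then have "Re (p z) > 0" "Re (p (\<i> * z)) > 0" "Re (p (- 1 * z)) > 0" "Re (p (- \<i> * z)) > 0"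
      by (auto intro!: pos simp: norm_mult)
    then show "Re (q z) > 0"
      unfolding q_def using uvw by (auto intro!: add_pos_nonneg mult_nonneg_nonneg)
  qed (rule holq)
  moreover have Q: "fps_nth (fps_expansion q 0) n = (u + v * \<i> ^ n + w * (- 1) ^ n + v * (- \<i>) ^ n) * fps_nth P n" for n
  proof -
    have "q has_fps_expansion fps_const u * P + fps_const v * (P oo (fps_const \<i> * fps_X))
      + fps_const w * (P oo (fps_const (- 1) * fps_X)) + fps_const v * (P oo (fps_const (- \<i>) * fps_X))"
      unfolding q_def
      by (intro has_fps_expansion_add has_fps_expansion_cmult_left rot_fps)
         (use disk_fps[OF holp] in \<open>simp add: P_def\<close>)
    then show ?thesis
      by (simp add: fps_expansion_eqI distrib_right mult.assoc del: fps_const_neg)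
  qed
  have "fps_nth (fps_expansion q 0) 1 = x * fps_nth P 1"
       "fps_nth (fps_expansion q 0) 2 = x\<^sup>2 * fps_nth P 2"
       "fps_nth (fps_expansion q 0) 3 = x * fps_nth P 3"
       "fps_nth (fps_expansion q 0) 4 = fps_nth P 4"
    unfolding Q u_def v_def w_def 
    by (auto simp: power2_eq_square power3_eq_cube power4_eq_xxxx field_simps)
  ultimately show ?thesis
    using that unfolding P_def by blast
qed

text \<open>Averaging over the fourth roots of unity leaves \<open>q z = 1 + p\<^sub>4 z\<^sup>4 + \<dots>\<close>. The function
  \<open>(q - 1) / (q + 1)\<close> is bounded by \<open>1\<close> and starts with \<open>p\<^sub>4 z\<^sup>4 / 2\<close>.\<close>

lemma caratheodory_coeff_4_le_2:
  assumes "caratheodory p"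
  shows "cmod (fps_nth (fps_expansion p 0) 4) \<le> 2"
proof -
  obtain q where q: "caratheodory q" 
    and Q: "fps_nth (fps_expansion q 0) 1 = 0" "fps_nth (fps_expansion q 0) 2 = 0"
    "fps_nth (fps_expansion q 0) 3 = 0"
    "fps_nth (fps_expansion q 0) 4 = fps_nth (fps_expansion p 0) 4"
    using caratheodory_rotation_average[OF assms, of 0] by auto
  define v where "v = (\<lambda>z. (q z - 1) / (q z + 1))"
  have holq: "q holomorphic_on unit_disk" using q by (simp add: caratheodory_def)
  have holv: "v holomorphic_on unit_disk"
    unfolding v_def using caratheodory_plus_1_nonzero[OF q] 
    by (auto intro!: holomorphic_intros holq)
  have "cmod (v z) \<le> 1" if "z \<in> unit_disk" for z
    using q that cmod_minus_1_less_plus_1[of "q z"] caratheodory_plus_1_nonzero[OF q that]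
    by (auto simp: v_def norm_divide caratheodory_def field_simps)
  then have le: "cmod (fps_nth (fps_expansion v 0) 4) \<le> 1"
    using bounded_coeff_le_1 holv by blast
  define V where "V = fps_expansion v 0"
  have "fps_expansion q 0 - 1 = V * (fps_expansion q 0 + 1)"
  proof -
    have "fps_expansion (\<lambda>z. q z - 1) 0 = V * (fps_expansion q 0 + 1)"
    proof (rule disk_fps_eqI)
      show "(\<lambda>z. v z * (q z + 1)) has_fps_expansion V * (fps_expansion q 0 + 1)"
        unfolding V_def by (intro fps_expansion_intros disk_fps holv holq)
      show "q z - 1 = v z * (q z + 1)" if "z \<in> unit_disk" for z
        using caratheodory_plus_1_nonzero[OF q that] by (simp add: v_def)
    qed (intro holomorphic_intros holq)
    moreover have "fps_expansion (\<lambda>z. q z - 1) 0 = fps_expansion q 0 - 1"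
      by (intro fps_expansion_eqI fps_expansion_intros disk_fps holq)
    ultimately show ?thesis by simp
  qed
  from arg_cong[OF this, of "\<lambda>F. fps_nth F 4"] 
  have "fps_nth (fps_expansion p 0) 4 = 2 * fps_nth V 4"
    using Q q by (simp add: fps_mult_coeffs caratheodory_def V_def v_def)
  with le show ?thesis by (simp add: V_def norm_mult)
qed

section \<open>A truncated moment problem\<close>

text \<open>Two-point Gauss quadrature for the truncated moment problem on \<open>[0, 1]\<close>. The nodes are the roots of
  the monic quadratic \<open>q y = y\<^sup>2 - b y - c\<close> that is orthogonal to \<open>1\<close> and \<open>y\<close> for the prescribed
  moments. The condition \<open>M1\<^sup>2 < M2\<close> makes \<open>q\<close> negative at the mean \<open>M1\<close>, and the last two conditions
  say that \<open>q\<close> is nonnegative at \<open>0\<close> and at \<open>1\<close>. So there is one root on each side of the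
  mean, inside \<open>[0, 1]\<close>, and the weights are those that give the mean \<open>M1\<close>.\<close>

lemma two_point_quadrature:
  fixes M1 M2 M3 :: real
  assumes "0 < M1" "M1 < 1" "M1\<^sup>2 < M2"
    and lo: "M2\<^sup>2 \<le> M1 * M3" and hi: "(M1 - M2)\<^sup>2 \<le> (1 - M1) * (M2 - M3)"
  obtains y1 y2 w where "0 \<le> y1" "y1 \<le> 1" "0 \<le> y2" "y2 \<le> 1" "0 \<le> w" "w \<le> 1"
    "w * y1 + (1 - w) * y2 = M1" "w * y1\<^sup>2 + (1 - w) * y2\<^sup>2 = M2" "w * y1 ^ 3 + (1 - w) * y2 ^ 3 = M3"
proof -
  define V where "V = M2 - M1\<^sup>2"
  have V: "V > 0" using assms by (simp add: V_def)
  define b c where "b = (M3 - M1 * M2) / V" and "c = M2 - b * M1"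
  have bV: "b * V = M3 - M1 * M2" using V by (simp add: b_def)
  \<comment> \<open>\<open>b\<close> and \<open>c\<close> solve the two orthogonality equations \<open>M2 = b M1 + c\<close> and \<open>M3 = b M2 + c M1\<close>.\<close>
  have M3: "M3 = b * M2 + c * M1"
    using bV by (simp add: c_def V_def power2_eq_square algebra_simps)
  have c: "c \<le> 0"
  proof -
    have "V * c = M2\<^sup>2 - M1 * M3"
      using bV by (simp add: c_def V_def power2_eq_square algebra_simps) algebra
    with lo V show ?thesis
      by (metis diff_le_0_iff_le mult_le_0_iff not_less)
  qed
  have bc: "0 \<le> 1 - b - c"
  proof -
    have "V * (1 - b - c) = (1 - M1) * (M2 - M3) - (M1 - M2)\<^sup>2"
      using bV by (simp add: c_def V_def power2_eq_square algebra_simps) algebra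
    then have "0 \<le> V * (1 - b - c)" using hi by simp
    with V show ?thesis by (simp add: zero_le_mult_iff)
  qed
  define q where "q = (\<lambda>y. y\<^sup>2 - b * y - c)"
  have qM1: "q M1 = - V" by (simp add: q_def c_def V_def power2_eq_square algebra_simps)
  have cont: "continuous_on A q" for A unfolding q_def by (intro continuous_intros)
  obtain y1 where y1: "0 \<le> y1" "y1 \<le> M1" "q y1 = 0"
    using IVT2'[of q M1 0 0] cont V qM1 c assms(1) by (auto simp: q_def)
  obtain y2 where y2: "M1 \<le> y2" "y2 \<le> 1" "q y2 = 0"
    using IVT'[of q M1 0 1] cont V qM1 bc assms(2) by (auto simp: q_def)
  have "y1 < M1" "M1 < y2" using y1 y2 qM1 V by (auto simp: less_le)
  then have lt: "y1 < y2" by simp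
  define w where "w = (y2 - M1) / (y2 - y1)"
  have w: "0 \<le> w" "w \<le> 1" using y1 y2 lt by (auto simp: w_def divide_simps)
  have s1: "w * y1 + (1 - w) * y2 = M1"
  proof -
    have "w * (y2 - y1) = y2 - M1" using lt by (simp add: w_def)
    then show ?thesis by (simp add: algebra_simps)
  qed
  have e: "y1\<^sup>2 = b * y1 + c" "y2\<^sup>2 = b * y2 + c"
    using y1 y2 by (auto simp: q_def)
  have e3: "y1 ^ 3 = b * y1\<^sup>2 + c * y1" "y2 ^ 3 = b * y2\<^sup>2 + c * y2"
    using e by (simp_all add: power3_eq_cube power2_eq_square algebra_simps)
  have "w * y1\<^sup>2 + (1 - w) * y2\<^sup>2 = b * (w * y1 + (1 - w) * y2) + c"
    unfolding e by (simp add: algebra_simps)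
  then have s2: "w * y1\<^sup>2 + (1 - w) * y2\<^sup>2 = M2"
    unfolding s1 by (simp add: c_def)
  have "w * y1 ^ 3 + (1 - w) * y2 ^ 3
      = b * (w * y1\<^sup>2 + (1 - w) * y2\<^sup>2) + c * (w * y1 + (1 - w) * y2)"
    unfolding e3 by (simp add: algebra_simps)
  then have s3: "w * y1 ^ 3 + (1 - w) * y2 ^ 3 = M3"
    unfolding s1 s2 by (simp add: M3)
  show ?thesis
    using that[OF y1(1) _ _ y2(2) w s1 s2 s3] y1 y2 assms by auto
qed

section \<open>Quartic functionals of Caratheodory functions\<close>

text \<open>With \<open>W = (q - 1) / (q + 1)\<close>, a function bounded by \<open>1\<close>, the function
  \<open>p = (1 + \<zeta> W) / (1 - \<zeta> W)\<close> is Caratheodory for unimodular \<open>\<zeta>\<close>. Writing \<open>g = q - 1\<close>, one has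
  \<open>p - 1 = \<zeta> g / (1 + \<kappa> g)\<close>, and the expression below is the coefficient of \<open>z\<^sup>4\<close> in the
  geometric series \<open>g - \<kappa> g\<^sup>2 + \<kappa>\<^sup>2 g\<^sup>3 - \<kappa>\<^sup>3 g\<^sup>4\<close>.\<close>

lemma caratheodory_moebius_coeff_4:
  assumes q: "caratheodory q" and \<zeta>: "cmod \<zeta> = 1"
  defines "Q \<equiv> fps_nth (fps_expansion q 0)" and "\<kappa> \<equiv> (1 - \<zeta>) / 2"
  shows "cmod (Q 4 - \<kappa> * (2 * Q 1 * Q 3 + (Q 2)\<^sup>2) + \<kappa>\<^sup>2 * (3 * (Q 1)\<^sup>2 * Q 2) - \<kappa> ^ 3 * Q 1 ^ 4) \<le> 2"
proof -
  have holq: "q holomorphic_on unit_disk" and q0: "q 0 = 1" using q by (auto simp: caratheodory_def)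
  define D where "D = (\<lambda>z. q z + 1 - \<zeta> * (q z - 1))"
  define p where "p = (\<lambda>z. (q z + 1 + \<zeta> * (q z - 1)) / D z)"
  have less: "cmod (\<zeta> * (q z - 1)) < cmod (q z + 1)" if "z \<in> unit_disk" for z
    using q that \<zeta> by (simp add: norm_mult cmod_minus_1_less_plus_1 caratheodory_def)
  then have D: "D z \<noteq> 0" if "z \<in> unit_disk" for z
    using that by (force simp: D_def)
  have holD: "D holomorphic_on unit_disk" unfolding D_def by (intro holomorphic_intros holq)
  have holp: "p holomorphic_on unit_disk"
    unfolding p_def using D by (auto intro!: holomorphic_intros holq holD)
  have p: "caratheodory p"
    unfolding caratheodory_def
  proof (intro conjI ballI holp)
    show "p 0 = 1" by (simp add: p_def D_def q0)
    fix z :: complex assume z: "z \<in> unit_disk"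
    have "p z - 1 = 2 * (\<zeta> * (q z - 1)) / D z" "p z + 1 = 2 * (q z + 1) / D z"
      using D[OF z] by (simp_all add: p_def divide_simps) (simp_all add: D_def algebra_simps)
    then have "cmod (p z - 1) = 2 * cmod (\<zeta> * (q z - 1)) / cmod (D z)"
      "cmod (p z + 1) = 2 * cmod (q z + 1) / cmod (D z)"
      by (simp_all only: norm_divide norm_mult norm_numeral)
    then have "cmod (p z - 1) < cmod (p z + 1)"
      using less[OF z] D[OF z] by (metis divide_strict_right_mono mult_less_cancel_left_pos zero_less_norm_iff zero_less_numeral)
    then show "0 < Re (p z)" by (simp add: cmod_minus_1_less_plus_1)
  qed
  define P where "P = fps_expansion p 0"
  define F where "F = fps_expansion q 0"
  have PF: "P * (F + 1 - fps_const \<zeta> * (F - 1)) = F + 1 + fps_const \<zeta> * (F - 1)"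
  proof -
    have "fps_expansion (\<lambda>z. q z + 1 + \<zeta> * (q z - 1)) 0 = P * (F + 1 - fps_const \<zeta> * (F - 1))"
    proof (rule disk_fps_eqI)
      show "(\<lambda>z. p z * D z) has_fps_expansion P * (F + 1 - fps_const \<zeta> * (F - 1))"
        unfolding P_def F_def D_def by (intro fps_expansion_intros disk_fps holp holq)
      show "q z + 1 + \<zeta> * (q z - 1) = p z * D z" if "z \<in> unit_disk" for z
        using D[OF that] by (simp add: p_def)
    qed (intro holomorphic_intros holq)
    moreover have "fps_expansion (\<lambda>z. q z + 1 + \<zeta> * (q z - 1)) 0 = F + 1 + fps_const \<zeta> * (F - 1)"
      unfolding F_def by (intro fps_expansion_eqI fps_expansion_intros disk_fps holq)
    ultimately show ?thesis by simp
  qed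
  have P0: "fps_nth P 0 = 1" "fps_nth F 0 = 1" 
    using p q0 by (simp_all add: P_def F_def caratheodory_def)
  have F: "fps_nth F n = Q n" for n by (simp add: F_def Q_def)
  have \<zeta>': "\<zeta> = 1 - 2 * \<kappa>" by (simp add: \<kappa>_def field_simps)
  have c: "fps_nth (P * (F + 1 - fps_const \<zeta> * (F - 1))) n = fps_nth (F + 1 + fps_const \<zeta> * (F - 1)) n" for n
    by (simp add: PF)
  have P1: "fps_nth P 1 = \<zeta> * Q 1"
    using c[of 1] P0 by (simp add: fps_mult_coeffs F algebra_simps)
  have P2: "fps_nth P 2 = \<zeta> * Q 2 - \<kappa> * fps_nth P 1 * Q 1"
    using c[of 2] P0 by (simp add: fps_mult_coeffs F \<kappa>_def field_simps)
  have P3: "fps_nth P 3 = \<zeta> * Q 3 - \<kappa> * (fps_nth P 1 * Q 2 + fps_nth P 2 * Q 1)"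
    using c[of 3] P0 by (simp add: fps_mult_coeffs F \<kappa>_def field_simps)
  have P4: "fps_nth P 4 = \<zeta> * Q 4 - \<kappa> * (fps_nth P 1 * Q 3 + fps_nth P 2 * Q 2 + fps_nth P 3 * Q 1)"
    using c[of 4] P0 by (simp add: fps_mult_coeffs F \<kappa>_def field_simps)
  have "fps_nth P 4 = \<zeta> * (Q 4 - \<kappa> * (2 * Q 1 * Q 3 + (Q 2)\<^sup>2) + \<kappa>\<^sup>2 * (3 * (Q 1)\<^sup>2 * Q 2) - \<kappa> ^ 3 * Q 1 ^ 4)"
    unfolding P4 P3 P2 P1 by (simp add: algebra_simps power2_eq_square power3_eq_cube power4_eq_xxxx)
  then show ?thesis
    using caratheodory_coeff_4_le_2[OF p] \<zeta> by (simp add: P_def norm_mult)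
qed

lemma cmod_convex_combination_le:
  assumes "cmod a \<le> c" "cmod b \<le> c" "0 \<le> w" "w \<le> (1::real)"
  shows "cmod (of_real w * a + of_real (1 - w) * b) \<le> c"
proof -
  have "cmod (of_real w * a + of_real (1 - w) * b) \<le> w * cmod a + (1 - w) * cmod b"
    using norm_triangle_ineq[of "of_real w * a" "of_real (1 - w) * b"] assms
    by (simp only: norm_mult norm_of_real abs_of_nonneg diff_ge_0_iff_ge)
  also have "\<dots> \<le> w * c + (1 - w) * c"
    using assms by (intro add_mono mult_left_mono) auto
  finally show ?thesis by (simp add: algebra_simps)
qed

text \<open>The mean of the previous bound over \<open>\<kappa>\<close> and its conjugate. The points \<open>\<kappa> = (1 - \<zeta>) / 2\<close> form the
  circle on which \<open>\<kappa> + cnj \<kappa> = 2 y\<close> and \<open>\<kappa> * cnj \<kappa> = y\<close>, so the real parts of \<open>\<kappa>\<close>,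
  \<open>\<kappa>\<^sup>2\<close>, \<open>\<kappa>\<^sup>3\<close> are polynomials in \<open>y\<close>.\<close>

lemma caratheodory_conjugate_pair_bound:
  fixes y :: real and Q :: "nat \<Rightarrow> complex"
  assumes q: "caratheodory q" and y: "0 \<le> y" "y \<le> 1"
  defines "Q \<equiv> fps_nth (fps_expansion q 0)"
  shows "cmod (Q 4 - y * (2 * Q 1 * Q 3 + (Q 2)\<^sup>2) + (2 * y\<^sup>2 - y) * (3 * (Q 1)\<^sup>2 * Q 2)
           - (4 * y ^ 3 - 3 * y\<^sup>2) * Q 1 ^ 4) \<le> 2"
proof -
  define t where "t = sqrt (y - y\<^sup>2)"
  have "y\<^sup>2 \<le> y" using y by (simp add: power2_eq_square mult_left_le)
  then have tt: "t * t = y - y * y" by (simp add: t_def flip: power2_eq_square)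
  define \<kappa> where "\<kappa> = Complex y t"
  have tt': "complex_of_real t * complex_of_real t = y - y * y"
    using arg_cong[OF tt, of complex_of_real] by simp
  have norm1: "cmod (1 - 2 * \<kappa>) = 1" "cmod (1 - 2 * cnj \<kappa>) = 1"
    using tt by (simp_all add: \<kappa>_def cmod_def power2_eq_square algebra_simps)
  have k: "\<kappa> = y + \<i> * t" "cnj \<kappa> = y - \<i> * t" 
    by (simp_all add: \<kappa>_def complex_eq_iff)
  have ksum: "\<kappa> + cnj \<kappa> = 2 * complex_of_real y" by (simp add: k)
  have kprod: "\<kappa> * cnj \<kappa> = y"
    by (simp add: k algebra_simps tt')
  have k2: "\<kappa>\<^sup>2 + (cnj \<kappa>)\<^sup>2 = 2 * (2 * (complex_of_real y)\<^sup>2 - complex_of_real y)"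
    using ksum kprod by algebra
  have k3: "\<kappa> ^ 3 + cnj \<kappa> ^ 3 = 2 * (4 * complex_of_real y ^ 3 - 3 * (complex_of_real y)\<^sup>2)"
    using ksum kprod by algebra
  define E where "E = (\<lambda>\<kappa>. Q 4 - \<kappa> * (2 * Q 1 * Q 3 + (Q 2)\<^sup>2) + \<kappa>\<^sup>2 * (3 * (Q 1)\<^sup>2 * Q 2) - \<kappa> ^ 3 * Q 1 ^ 4)"
  have "cmod (E \<kappa>) \<le> 2" "cmod (E (cnj \<kappa>)) \<le> 2"
    using caratheodory_moebius_coeff_4[OF q norm1(1)] caratheodory_moebius_coeff_4[OF q norm1(2)]
    by (simp_all add: E_def Q_def)
  then have "cmod (of_real (1/2) * E \<kappa> + of_real (1 - 1/2) * E (cnj \<kappa>)) \<le> 2"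
    by (rule cmod_convex_combination_le) auto
  also have "of_real (1/2) * E \<kappa> + of_real (1 - 1/2) * E (cnj \<kappa>) = (E \<kappa> + E (cnj \<kappa>)) / 2"
    by (simp add: field_simps)
  also have "E \<kappa> + E (cnj \<kappa>) = 2 * Q 4 - (\<kappa> + cnj \<kappa>) * (2 * Q 1 * Q 3 + (Q 2)\<^sup>2)
      + (\<kappa>\<^sup>2 + (cnj \<kappa>)\<^sup>2) * (3 * (Q 1)\<^sup>2 * Q 2) - (\<kappa> ^ 3 + cnj \<kappa> ^ 3) * Q 1 ^ 4"
    unfolding E_def by (simp add: algebra_simps)
  also have "\<dots> = 2 * (Q 4 - y * (2 * Q 1 * Q 3 + (Q 2)\<^sup>2) + (2 * y\<^sup>2 - y) * (3 * (Q 1)\<^sup>2 * Q 2)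
      - (4 * y ^ 3 - 3 * y\<^sup>2) * Q 1 ^ 4)"
    unfolding ksum k2 k3 by (simp add: algebra_simps)
  finally show ?thesis
    by (simp only: nonzero_mult_div_cancel_left zero_neq_numeral[symmetric] not_False_eq_True)
qed

text \<open>The previous bound is affine in \<open>(y, y\<^sup>2, y\<^sup>3)\<close>, so it may be averaged over any probability measure
  on \<open>[0, 1]\<close>; by quadrature, a measure with two atoms already realises the given moments.\<close>

lemma caratheodory_moment_bound:
  fixes M1 M2 M3 :: real and Q :: "nat \<Rightarrow> complex"
  assumes q: "caratheodory q"
    and M: "0 < M1" "M1 < 1" "M1\<^sup>2 < M2" "M2\<^sup>2 \<le> M1 * M3" "(M1 - M2)\<^sup>2 \<le> (1 - M1) * (M2 - M3)"
  defines "Q \<equiv> fps_nth (fps_expansion q 0)"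
  shows "cmod (Q 4 - M1 * (2 * Q 1 * Q 3 + (Q 2)\<^sup>2) + (2 * M2 - M1) * (3 * (Q 1)\<^sup>2 * Q 2)
           - (4 * M3 - 3 * M2) * Q 1 ^ 4) \<le> 2"
proof -
  obtain y1 y2 w where y: "0 \<le> y1" "y1 \<le> 1" "0 \<le> y2" "y2 \<le> 1" and w: "0 \<le> w" "w \<le> 1"
    and m: "w * y1 + (1 - w) * y2 = M1" "w * y1\<^sup>2 + (1 - w) * y2\<^sup>2 = M2"
      "w * y1 ^ 3 + (1 - w) * y2 ^ 3 = M3"
    using two_point_quadrature[OF M] by blast
  define E where "E = (\<lambda>y::real. Q 4 - y * (2 * Q 1 * Q 3 + (Q 2)\<^sup>2)
      + (2 * y\<^sup>2 - y) * (3 * (Q 1)\<^sup>2 * Q 2) - (4 * y ^ 3 - 3 * y\<^sup>2) * Q 1 ^ 4)"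
  have "cmod (w * E y1 + (1 - w) * E y2) \<le> 2"
    using caratheodory_conjugate_pair_bound[OF q] y w
    by (intro cmod_convex_combination_le) (auto simp: E_def Q_def)
  also have "w * E y1 + (1 - w) * E y2 = Q 4 - M1 * (2 * Q 1 * Q 3 + (Q 2)\<^sup>2)
      + (2 * M2 - M1) * (3 * (Q 1)\<^sup>2 * Q 2) - (4 * M3 - 3 * M2) * Q 1 ^ 4"
    unfolding E_def m[symmetric] by (simp add: algebra_simps)
  finally show ?thesis .
qed

text \<open>The four coefficients \<open>\<alpha>\<close>, \<open>a\<close>, \<open>\<beta>\<close>, \<open>\<gamma>\<close> are matched by three moments and the parameter \<open>x\<close> of
  the rotation average. In the moment bound \<open>q\<^sub>1 q\<^sub>3\<close> and \<open>q\<^sub>2\<^sup>2\<close> occur in the fixed ratio \<open>2 : 1\<close>;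
  for the rotation average they become \<open>x\<^sup>2 p\<^sub>1 p\<^sub>3\<close> and \<open>x\<^sup>4 p\<^sub>2\<^sup>2\<close>, which forces
  \<open>x\<^sup>2 = a / \<alpha>\<close> and so needs \<open>a \<le> \<alpha>\<close>. The moments are then determined rational expressions, and the remaining
  hypotheses are the moment conditions for them, with denominators cleared.\<close>

lemma caratheodory_quartic_bound:
  fixes \<alpha> a \<beta> \<gamma> :: real and P :: "nat \<Rightarrow> complex"
  assumes p: "caratheodory p"
    and a: "0 < a" "a \<le> \<alpha>" "\<alpha>\<^sup>2 < a"
    and \<beta>: "4 * \<alpha>\<^sup>2 < 2 * a + \<beta>"
    and lo: "(2 * a + \<beta>)\<^sup>2 \<le> a * (4 * \<gamma> + 6 * a + 3 * \<beta>)"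
    and hi: "\<alpha>\<^sup>2 * (2 * a - \<beta>)\<^sup>2 \<le> a * (a - \<alpha>\<^sup>2) * (2 * a + \<beta> - 4 * \<gamma>)"
  defines "P \<equiv> fps_nth (fps_expansion p 0)"
  shows "cmod (P 4 - 2 * \<alpha> * P 1 * P 3 - a * (P 2)\<^sup>2 + 3 / 2 * \<beta> * (P 1)\<^sup>2 * P 2 - \<gamma> * P 1 ^ 4) \<le> 2"
proof -
  define x where "x = sqrt (a / \<alpha>)"
  have \<alpha>: "\<alpha> > 0" using a by simp
  have x: "0 \<le> x" "x \<le> 1" and xx: "x\<^sup>2 = a / \<alpha>"
    using a \<alpha> by (auto simp: x_def)
  obtain q where q: "caratheodory q" and 
    Q: "fps_nth (fps_expansion q 0) 1 = x * P 1" "fps_nth (fps_expansion q 0) 2 = x\<^sup>2 * P 2"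
      "fps_nth (fps_expansion q 0) 3 = x * P 3" "fps_nth (fps_expansion q 0) 4 = P 4"
    using caratheodory_rotation_average[OF p x] unfolding P_def by blast
  \<comment> \<open>The solution of \<open>M1 x\<^sup>2 = \<alpha>\<close>, \<open>(2 M2 - M1) x\<^sup>4 = \<beta> / 2\<close> and \<open>(4 M3 - 3 M2) x\<^sup>4 = \<gamma>\<close>.\<close>
  define M1 M2 M3 where "M1 = \<alpha>\<^sup>2 / a" and "M2 = \<alpha>\<^sup>2 * (2 * a + \<beta>) / (4 * a\<^sup>2)"
    and "M3 = \<alpha>\<^sup>2 * (4 * \<gamma> + 6 * a + 3 * \<beta>) / (16 * a\<^sup>2)"
  have 1: "0 < M1" "M1 < 1" using a \<alpha> by (auto simp: M1_def)
  have "M2 - M1\<^sup>2 = \<alpha>\<^sup>2 * (2 * a + \<beta> - 4 * \<alpha>\<^sup>2) / (4 * a\<^sup>2)"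
    using a by (simp add: M1_def M2_def field_simps power2_eq_square)
  also have "\<dots> > 0" using \<beta> \<alpha> a by auto
  finally have 2: "M1\<^sup>2 < M2" by simp
  have "M1 * M3 - M2\<^sup>2 = \<alpha> ^ 4 / (16 * a ^ 4) * (a * (4 * \<gamma> + 6 * a + 3 * \<beta>) - (2 * a + \<beta>)\<^sup>2)"
    using a by (simp add: M1_def M2_def M3_def field_simps eval_nat_numeral)
  also have "\<dots> \<ge> 0" using lo by (intro mult_nonneg_nonneg) auto
  finally have 3: "M2\<^sup>2 \<le> M1 * M3" by simp
  have "(1 - M1) * (M2 - M3) - (M1 - M2)\<^sup>2
      = \<alpha>\<^sup>2 / (16 * a ^ 4) * (a * (a - \<alpha>\<^sup>2) * (2 * a + \<beta> - 4 * \<gamma>) - \<alpha>\<^sup>2 * (2 * a - \<beta>)\<^sup>2)"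
    using a by (simp add: M1_def M2_def M3_def field_simps eval_nat_numeral)
  also have "\<dots> \<ge> 0" using hi by (intro mult_nonneg_nonneg) auto
  finally have 4: "(M1 - M2)\<^sup>2 \<le> (1 - M1) * (M2 - M3)" by simp
  define X where "X = complex_of_real x"
  have "X\<^sup>2 = complex_of_real (x\<^sup>2)" by (simp add: X_def)
  then have X2: "X\<^sup>2 = a / \<alpha>" by (simp add: xx)
  have "X ^ 4 = (X\<^sup>2)\<^sup>2" by (simp flip: power_mult)
  then have X4: "X ^ 4 = (a / \<alpha>)\<^sup>2" by (simp add: X2)
  have e1: "M1 * (a / \<alpha>) = \<alpha>" "M1 * (a / \<alpha>)\<^sup>2 = a" "(2 * M2 - M1) * (a / \<alpha>)\<^sup>2 = \<beta> / 2"
    "(4 * M3 - 3 * M2) * (a / \<alpha>)\<^sup>2 = \<gamma>"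
    using a \<alpha> by (simp_all add: M1_def M2_def M3_def field_simps power2_eq_square)
  define m1 m2 m3 where "m1 = complex_of_real M1" and "m2 = complex_of_real (2 * M2 - M1)"
    and "m3 = complex_of_real (4 * M3 - 3 * M2)"
  have e: "m1 * X\<^sup>2 = \<alpha>" "m1 * X ^ 4 = a" "m2 * X ^ 4 = \<beta> / 2" "m3 * X ^ 4 = \<gamma>"
    using e1[THEN arg_cong[of _ _ complex_of_real]] by (simp_all add: m1_def m2_def m3_def X2 X4)
  have "cmod (P 4 - m1 * (2 * (X * P 1) * (X * P 3) + (X\<^sup>2 * P 2)\<^sup>2)
      + m2 * (3 * (X * P 1)\<^sup>2 * (X\<^sup>2 * P 2)) - m3 * (X * P 1) ^ 4) \<le> 2"
    using caratheodory_moment_bound[OF q 1 2 3 4] unfolding Q X_def m1_def m2_def m3_def by simp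
  also have "P 4 - m1 * (2 * (X * P 1) * (X * P 3) + (X\<^sup>2 * P 2)\<^sup>2)
      + m2 * (3 * (X * P 1)\<^sup>2 * (X\<^sup>2 * P 2)) - m3 * (X * P 1) ^ 4
    = P 4 - 2 * (m1 * X\<^sup>2) * P 1 * P 3 - (m1 * X ^ 4) * (P 2)\<^sup>2
      + 3 * (m2 * X ^ 4) * (P 1)\<^sup>2 * P 2 - (m3 * X ^ 4) * P 1 ^ 4"
    by (simp add: algebra_simps eval_nat_numeral)
  finally show ?thesis
    unfolding e by simp
qed

section \<open>The conditions on the coefficients\<close>

text \<open>With \<open>B\<^sub>1 = t\<close>, \<open>B\<^sub>2 = t P\<close>, \<open>B\<^sub>3 = t R\<close>, \<open>B\<^sub>4 = t S\<close>, the four conditions on the coefficients are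
  the moment conditions for the functional that represents \<open>a\<^sub>5\<close>. The fourth condition allows
  \<open>a\<close> and \<open>\<alpha>\<close> to be both negative; the first one excludes this and then says \<open>t < 1 - P\<^sup>2\<close>.
  These determine the signs inside the absolute values of the other two conditions. The two halves
  of the third condition factor through the two determinants that must be positive.\<close>

lemma coefficient_conditions:
  fixes t P R S :: real
  assumes t: "t > 0"
    and C1: "cond_C1 t (t * P)" and C2: "cond_C2 t (t * P) (t * R)"
    and C3: "cond_C3 t (t * P) (t * R) (t * S)" and C4: "cond_C4 t (t * P)"
  defines "\<alpha> \<equiv> (1 - P) / 2" and "a \<equiv> (1 - (P + t / 2)) / 2"
    and "\<beta> \<equiv> (3 - 4 * P - 2 * (P + t / 2) + (3 * R + t * P)) / 6"
    and "\<gamma> \<equiv> (1 - 2 * P - (P + t / 2) + (3 * R + t * P) - (S + t * P\<^sup>2 / 2)) / 8"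
  shows "0 < a" "a \<le> \<alpha>" "\<alpha>\<^sup>2 < a" "4 * \<alpha>\<^sup>2 < 2 * a + \<beta>"
    "(2 * a + \<beta>)\<^sup>2 < a * (4 * \<gamma> + 6 * a + 3 * \<beta>)"
    "\<alpha>\<^sup>2 * (2 * a - \<beta>)\<^sup>2 < a * (a - \<alpha>\<^sup>2) * (2 * a + \<beta> - 4 * \<gamma>)"
proof -
  define N where "N = t^7 - t^6*(8*(t*P) + 3)
       - 6*t^4*((t*P)*(3*(t*P) + 2*(t*R) + 2) - 6*(t*R) + 9*(t*S))
       + t^5*(7*(t*P)*((t*P) + 4) - 24*(t*R) + 18*(t*S))
       + 6*t^3*((t*P)^3 - 2*(t*P)^2 + 8*(t*P)*(t*R) - 3*(t*R)^2 + 6*((t*P) + 1)*(t*S))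
       - 6*t*(t*P)*(3*(t*P)^3 - 6*(t*R)^2 + (t*P)^2*(4*(t*R) - 6) + 6*(t*P)*((t*S) - 2*(t*R)))
       + 18*(t*P)^2*(- 2*(t*R)^2 + (t*P)*(((t*P) - 2)*(t*P) + 2*(t*S)))
       + t^2*(t*P)*((t*P)*((t*P)*(5*(t*P) + 6) - 24*(t*R) + 18*(t*S)) - 36*(2*(t*R) + (t*S)))"
  define K where "K = ((t - 2)*t + 2*(t*P)) * (t*(2*t + (t*P) - 3) + 3*(t*R))
             * (4*t^3 + 6*(t*P)^2 - t^2*((t*P) + 3) - 3*t*(t*R))"
  have C1': "\<bar>t - 2 * P * (1 - P)\<bar> < \<bar>2 - t - 2 * P\<bar>"
  proof -
    have "t^3 - 2*t*(t*P) + 2*(t*P)^2 = t\<^sup>2 * (t - 2 * P * (1 - P))"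
      "2*t^2 - t^3 - 2*t*(t*P) = t\<^sup>2 * (2 - t - 2 * P)"
      by (simp_all add: algebra_simps power2_eq_square power3_eq_cube)
    with C1 t show ?thesis by (simp add: cond_C1_def abs_mult)
  qed
  have C2': "\<bar>t - t * P + 3 * P\<^sup>2 - 3 * R\<bar> < 3 * \<bar>t - 1 + P\<^sup>2\<bar>"
  proof -
    have "t^3 - t^2*(t*P) + 3*(t*P)^2 - 3*t*(t*R) = t\<^sup>2 * (t - t * P + 3 * P\<^sup>2 - 3 * R)"
      "t^3 - t^2 + (t*P)^2 = t\<^sup>2 * (t - 1 + P\<^sup>2)"
      by (simp_all add: algebra_simps power2_eq_square power3_eq_cube)
    with C2 t show ?thesis by (simp add: cond_C2_def abs_mult)
  qed
  have C4': "0 < (2 - t - 2 * P) / (2 * (1 - P))" "(2 - t - 2 * P) / (2 * (1 - P)) < 1"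
  proof -
    have "2*t - t^2 - 2*(t*P) = t * (2 - t - 2 * P)" "2*(t - t*P) = t * (2 * (1 - P))"
      by (simp_all add: algebra_simps power2_eq_square)
    with C4 t show "0 < (2 - t - 2 * P) / (2 * (1 - P))" "(2 - t - 2 * P) / (2 * (1 - P)) < 1" 
      by (simp_all add: cond_C4_def del: right_diff_distrib_numeral)
  qed
  \<comment> \<open>If \<open>P \<ge> 1\<close>, the first condition would imply \<open>(P - 1)\<^sup>2 < 0\<close>.\<close>
  have P1: "P < 1"
  proof (rule ccontr)
    assume "\<not> P < 1"
    then have P: "1 \<le> P" and neg: "2 - t - 2 * P < 0" using t by auto
    have "0 \<le> (P - 1)\<^sup>2" by simp
    then have "t - 2 * P * (1 - P) \<ge> t + 2 * P - 2" by (simp add: power2_eq_square algebra_simps)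
    with C1' neg show False by linarith
  qed
  then have a4: "0 < 2 - t - 2 * P" using C4'(1) by (simp add: zero_less_divide_iff)
  then show a: "0 < a" by (simp add: a_def)
  show "a \<le> \<alpha>" using t by (simp add: a_def \<alpha>_def)
  have tP: "t < 1 - P\<^sup>2"
    using C1' a4 by (simp add: abs_if power2_eq_square algebra_simps split: if_splits)
  then show \<alpha>a: "\<alpha>\<^sup>2 < a"
    by (simp add: \<alpha>_def a_def power2_eq_square field_simps)
  have b1: "t - t * P + 3 * P\<^sup>2 - 3 * R < 3 * (1 - t - P\<^sup>2)"
    and b2: "- (t - t * P + 3 * P\<^sup>2 - 3 * R) < 3 * (1 - t - P\<^sup>2)"
  proof -
    have "\<bar>t - 1 + P\<^sup>2\<bar> = 1 - t - P\<^sup>2" using tP by simp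
    with C2' have "\<bar>t - t * P + 3 * P\<^sup>2 - 3 * R\<bar> < 3 * (1 - t - P\<^sup>2)" by simp
    then show "t - t * P + 3 * P\<^sup>2 - 3 * R < 3 * (1 - t - P\<^sup>2)"
      "- (t - t * P + 3 * P\<^sup>2 - 3 * R) < 3 * (1 - t - P\<^sup>2)"
      unfolding abs_less_iff by simp_all
  qed
  show "4 * \<alpha>\<^sup>2 < 2 * a + \<beta>"
    using b1 by (simp add: \<alpha>_def a_def \<beta>_def power2_eq_square field_simps)
  have K: "K = t ^ 4 * ((2 - t - 2 * P) * (3 - 2 * t - t * P - 3 * R) * (4 * t + 6 * P\<^sup>2 - t * P - 3 - 3 * R))"
    by (simp add: K_def algebra_simps power2_eq_square power3_eq_cube power4_eq_xxxx)
  have "K < 0"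
    unfolding K
  proof (intro mult_pos_neg mult_pos_pos)
    show "3 - 2 * t - t * P - 3 * R > 0" using b2 by simp
    show "4 * t + 6 * P\<^sup>2 - t * P - 3 - 3 * R < 0" using b1 by simp
  qed (use a4 t in auto)
  moreover have "\<bar>N\<bar> < 2 * \<bar>K\<bar>"
    using C3 by (simp only: cond_C3_def N_def K_def)
  ultimately have N: "2 * K + N < 0" "2 * K - N < 0" by linarith+
  \<comment> \<open>Multiples of \<open>a\<close>, \<open>\<beta>\<close>, \<open>\<gamma>\<close>, \<open>a - \<alpha>\<^sup>2\<close> that clear denominators: the two factorisations
    become identities between polynomials with integer coefficients.\<close>
  define A b G U where "A = 2 - 2 * P - t" and "b = 3 - 6 * P - t + 3 * R + t * P"
    and "G = 2 - 6 * P - t + 6 * R + 2 * t * P - 2 * S - t * P\<^sup>2" and "U = 1 - t - P\<^sup>2"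
  have sub: "a = A / 4" "\<beta> = b / 6" "\<gamma> = G / 16" "a - \<alpha>\<^sup>2 = U / 4" "\<alpha>\<^sup>2 = (1 - P)\<^sup>2 / 4"
    by (simp_all add: a_def \<beta>_def \<gamma>_def \<alpha>_def A_def b_def G_def U_def power2_eq_square field_simps)
  have "2 * K + N = - (t ^ 4 * U * (9 * A * (G + 6 * A + 2 * b) - (6 * A + 2 * b)\<^sup>2))"
    unfolding K N_def A_def b_def G_def U_def by algebra
  also have "9 * A * (G + 6 * A + 2 * b) - (6 * A + 2 * b)\<^sup>2
      = 144 * (a * (4 * \<gamma> + 6 * a + 3 * \<beta>) - (2 * a + \<beta>)\<^sup>2)"
    unfolding sub by (simp add: power2_eq_square field_simps)
  finally have pos: "0 < t ^ 4 * U * (144 * (a * (4 * \<gamma> + 6 * a + 3 * \<beta>) - (2 * a + \<beta>)\<^sup>2))"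
    using N(1) by simp
  have "0 < t ^ 4 * U" using t tP by (simp add: U_def)
  from zero_less_mult_pos[OF pos this] show "(2 * a + \<beta>)\<^sup>2 < a * (4 * \<gamma> + 6 * a + 3 * \<beta>)"
    by simp
  have "2 * K - N = - (t ^ 4 * (3 * A * U * (6 * A + 2 * b - 3 * G) - 4 * (1 - P)\<^sup>2 * (3 * A - b)\<^sup>2))"
    unfolding K N_def A_def b_def G_def U_def by algebra
  also have "3 * A * U * (6 * A + 2 * b - 3 * G) - 4 * (1 - P)\<^sup>2 * (3 * A - b)\<^sup>2
      = 576 * (a * (a - \<alpha>\<^sup>2) * (2 * a + \<beta> - 4 * \<gamma>) - \<alpha>\<^sup>2 * (2 * a - \<beta>)\<^sup>2)"
    unfolding sub(4) unfolding sub by (simp add: power2_eq_square field_simps)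
  finally have "0 < t ^ 4 * (576 * (a * (a - \<alpha>\<^sup>2) * (2 * a + \<beta> - 4 * \<gamma>) - \<alpha>\<^sup>2 * (2 * a - \<beta>)\<^sup>2))"
    using N(2) by simp
  then show "\<alpha>\<^sup>2 * (2 * a - \<beta>)\<^sup>2 < a * (a - \<alpha>\<^sup>2) * (2 * a + \<beta> - 4 * \<gamma>)"
    using t by (simp add: zero_less_mult_iff)
qed

section \<open>The fifth coefficient\<close>

definition schwarz :: "(complex \<Rightarrow> complex) \<Rightarrow> bool" where
  "schwarz w \<longleftrightarrow> w holomorphic_on unit_disk \<and> w ` unit_disk \<subseteq> unit_disk \<and> w 0 = 0"

text \<open>The Caratheodory function \<open>(1 + w) / (1 - w)\<close> turns the quartic bound into one for Schwarz functions;
  \<open>\<alpha>\<close>, \<open>a\<close>, \<open>\<beta>\<close>, \<open>\<gamma>\<close> are the coefficients after this substitution.\<close>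

lemma schwarz_quartic_bound:
  fixes \<mu> \<nu> \<rho> \<sigma> :: real and W :: "nat \<Rightarrow> complex"
  assumes w: "schwarz w"
  defines "\<alpha> \<equiv> (1 - \<mu>) / 2" and "a \<equiv> (1 - \<nu>) / 2" and "\<beta> \<equiv> (3 - 4 * \<mu> - 2 * \<nu> + \<rho>) / 6"
    and "\<gamma> \<equiv> (1 - 2 * \<mu> - \<nu> + \<rho> - \<sigma>) / 8"
  assumes cond: "0 < a" "a \<le> \<alpha>" "\<alpha>\<^sup>2 < a" "4 * \<alpha>\<^sup>2 < 2 * a + \<beta>"
    "(2 * a + \<beta>)\<^sup>2 \<le> a * (4 * \<gamma> + 6 * a + 3 * \<beta>)"
    "\<alpha>\<^sup>2 * (2 * a - \<beta>)\<^sup>2 \<le> a * (a - \<alpha>\<^sup>2) * (2 * a + \<beta> - 4 * \<gamma>)"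
  defines "W \<equiv> fps_nth (fps_expansion w 0)"
  shows "cmod (W 4 + 2 * \<mu> * W 1 * W 3 + \<nu> * (W 2)\<^sup>2 + \<rho> * (W 1)\<^sup>2 * W 2 + \<sigma> * W 1 ^ 4) \<le> 1"
proof -
  have holw: "w holomorphic_on unit_disk" and w0: "w 0 = 0" 
    and wlt: "\<And>z. z \<in> unit_disk \<Longrightarrow> cmod (w z) < 1"
    using w by (auto simp: schwarz_def image_subset_iff)
  have wne: "1 - w z \<noteq> 0" if "z \<in> unit_disk" for z
    using wlt[OF that] by force
  define p where "p = (\<lambda>z. (1 + w z) / (1 - w z))"
  have holp: "p holomorphic_on unit_disk"
    unfolding p_def using wne by (auto intro!: holomorphic_intros holw)
  have p: "caratheodory p"
    unfolding caratheodory_def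
  proof (intro conjI ballI holp)
    show "p 0 = 1" by (simp add: p_def w0)
    fix z :: complex assume z: "z \<in> unit_disk"
    have "p z - 1 = w z * (2 / (1 - w z))" "p z + 1 = 2 / (1 - w z)"
      using wne[OF z] by (simp_all add: p_def divide_simps)
    then have "cmod (p z - 1) = cmod (w z) * cmod (p z + 1)" and "p z + 1 \<noteq> 0"
      using wne[OF z] by (simp_all add: norm_mult norm_divide)
    then have "cmod (p z - 1) < cmod (p z + 1)"
      using wlt[OF z] by simp
    then show "0 < Re (p z)" by (simp add: cmod_minus_1_less_plus_1)
  qed
  define F G where "F = fps_expansion p 0" and "G = fps_expansion w 0"
  have FG: "F * (1 - G) = 1 + G"
  proof -
    have "fps_expansion (\<lambda>z. 1 + w z) 0 = F * (1 - G)"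
    proof (rule disk_fps_eqI)
      show "(\<lambda>z. p z * (1 - w z)) has_fps_expansion F * (1 - G)"
        unfolding F_def G_def by (intro fps_expansion_intros disk_fps holp holw)
      show "1 + w z = p z * (1 - w z)" if "z \<in> unit_disk" for z
        using wne[OF that] by (simp add: p_def)
    qed (intro holomorphic_intros holw)
    moreover have "fps_expansion (\<lambda>z. 1 + w z) 0 = 1 + G"
      unfolding G_def by (intro fps_expansion_eqI fps_expansion_intros disk_fps holw)
    ultimately show ?thesis by simp
  qed
  have c: "fps_nth (F * (1 - G)) n = fps_nth (1 + G) n" for n by (simp add: FG)
  have F0: "fps_nth F 0 = 1" "fps_nth G 0 = 0" using p by (simp_all add: F_def G_def caratheodory_def w0)
  have G: "fps_nth G n = W n" for n by (simp add: G_def W_def)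
  have F1: "fps_nth F 1 = 2 * W 1"
    using c[of 1] F0 by (simp add: fps_mult_coeffs G algebra_simps)
  have F2: "fps_nth F 2 = 2 * W 2 + fps_nth F 1 * W 1"
    using c[of 2] F0 by (simp add: fps_mult_coeffs G algebra_simps)
  have F3: "fps_nth F 3 = 2 * W 3 + fps_nth F 1 * W 2 + fps_nth F 2 * W 1"
    using c[of 3] F0 by (simp add: fps_mult_coeffs G algebra_simps)
  have F4: "fps_nth F 4 = 2 * W 4 + fps_nth F 1 * W 3 + fps_nth F 2 * W 2 + fps_nth F 3 * W 1"
    using c[of 4] F0 by (simp add: fps_mult_coeffs G algebra_simps)
  have params: "\<mu> = 1 - 2 * \<alpha>" "\<nu> = 1 - 2 * a" "\<rho> = 3 - 8 * \<alpha> - 4 * a + 6 * \<beta>"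
    "\<sigma> = 1 - 4 * \<alpha> - 2 * a + 6 * \<beta> - 8 * \<gamma>"
    by (simp_all add: \<alpha>_def a_def \<beta>_def \<gamma>_def field_simps)
  have "cmod (fps_nth F 4 - 2 * \<alpha> * fps_nth F 1 * fps_nth F 3 - a * (fps_nth F 2)\<^sup>2
      + 3 / 2 * \<beta> * (fps_nth F 1)\<^sup>2 * fps_nth F 2 - \<gamma> * fps_nth F 1 ^ 4) \<le> 2"
    using caratheodory_quartic_bound[OF p cond] unfolding F_def .
  also have "fps_nth F 4 - 2 * \<alpha> * fps_nth F 1 * fps_nth F 3 - a * (fps_nth F 2)\<^sup>2
      + 3 / 2 * \<beta> * (fps_nth F 1)\<^sup>2 * fps_nth F 2 - \<gamma> * fps_nth F 1 ^ 4
    = 2 * (W 4 + 2 * \<mu> * W 1 * W 3 + \<nu> * (W 2)\<^sup>2 + \<rho> * (W 1)\<^sup>2 * W 2 + \<sigma> * W 1 ^ 4)"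
    unfolding F4 F3 F2 F1 params
    by (simp add: algebra_simps power2_eq_square power4_eq_xxxx)
  finally show ?thesis
    unfolding norm_mult norm_numeral by linarith
qed

text \<open>Only the odd coefficients survive in \<open>f z - f (- z)\<close>. With \<open>\<phi> \<circ> w = 1 + d\<^sub>1 z + d\<^sub>2 z\<^sup>2 + \<dots>\<close>,
  comparing the coefficients of \<open>z\<^sup>3\<close> and \<open>z\<^sup>5\<close> gives \<open>2 a\<^sub>3 = d\<^sub>2\<close> and
  \<open>4 a\<^sub>5 = d\<^sub>4 + a\<^sub>3 d\<^sub>2\<close>.\<close>

lemma fifth_coefficient_formula:
  fixes A b W :: "nat \<Rightarrow> complex"
  assumes f: "f \<in> class_A" and hol\<phi>: "\<phi> holomorphic_on unit_disk" and \<phi>0: "\<phi> 0 = 1" and w: "schwarz w"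
    and eq: "\<And>z. z \<in> unit_disk \<Longrightarrow> 2 * z * deriv f z = (f z - f (- z)) * \<phi> (w z)"
  defines "A \<equiv> fps_nth (fps_expansion f 0)" and "b \<equiv> fps_nth (fps_expansion \<phi> 0)"
    and "W \<equiv> fps_nth (fps_expansion w 0)"
  shows "4 * A 5 = b 1 * W 4 + b 2 * (2 * W 1 * W 3 + (W 2)\<^sup>2) + b 3 * (3 * (W 1)\<^sup>2 * W 2)
           + b 4 * W 1 ^ 4 + (b 1 * W 2 + b 2 * (W 1)\<^sup>2)\<^sup>2 / 2"
proof -
  have holf: "f holomorphic_on unit_disk" and f0: "f 0 = 0" and f1: "deriv f 0 = 1"
    using f by (auto simp: class_A_def)
  have holw: "w holomorphic_on unit_disk" and w0: "w 0 = 0"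
    using w by (auto simp: schwarz_def)
  define F \<Phi> G where "F = fps_expansion f 0" and "\<Phi> = fps_expansion \<phi> 0" and "G = fps_expansion w 0"
  have G0: "fps_nth G 0 = 0" by (simp add: G_def w0)
  have "fps_expansion (\<lambda>z. 2 * z * deriv f z) 0 = (F - (F oo (fps_const (- 1) * fps_X))) * (\<Phi> oo G)"
  proof (rule disk_fps_eqI)
    show "(\<lambda>z. (f z - f (- 1 * z)) * (\<phi> \<circ> w) z) has_fps_expansion
        (F - (F oo (fps_const (- 1) * fps_X))) * (\<Phi> oo G)"
      unfolding F_def \<Phi>_def G_def
      by (intro has_fps_expansion_mult has_fps_expansion_diff has_fps_expansion_rotate
          has_fps_expansion_compose disk_fps holf hol\<phi> holw) (simp add: w0)
  qed (use eq in \<open>auto intro!: holomorphic_intros holf\<close>)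
  moreover have "fps_expansion (\<lambda>z. 2 * z * deriv f z) 0 = fps_const 2 * fps_X * fps_deriv F"
    unfolding F_def
    by (intro fps_expansion_eqI has_fps_expansion_mult has_fps_expansion_cmult_left
        has_fps_expansion_fps_X has_fps_expansion_deriv disk_fps holf)
  ultimately have c: "fps_nth (fps_const 2 * fps_X * fps_deriv F) n
      = fps_nth ((F - (F oo (fps_const (- 1) * fps_X))) * (\<Phi> oo G)) n" for n by simp
  have odd: "fps_nth (F - (F oo (fps_const (- 1) * fps_X))) n = (1 - (- 1) ^ n) * fps_nth F n" for n
    unfolding fps_sub_nth fps_nth_compose_linear by (simp add: algebra_simps)
  have lhs: "fps_nth (fps_const 2 * fps_X * fps_deriv F) n = 2 * of_nat n * fps_nth F n" for n
    by (cases n) (simp_all add: mult.assoc)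
  have F01: "fps_nth F 0 = 0" "fps_nth F 1 = 1"
    using f0 f1 by (simp_all add: F_def fps_expansion_def)
  have d0: "fps_nth (\<Phi> oo G) 0 = 1" by (simp add: \<Phi>_def \<phi>0)
  define d where "d = fps_nth (\<Phi> oo G)"
  have "2 * fps_nth F 3 = d 2"
    using c[of 3] d0 unfolding lhs fps_mult_coeffs odd d_def by (simp add: F01 F01(2)[unfolded One_nat_def] d0)
  moreover have "4 * fps_nth F 5 = d 4 + fps_nth F 3 * d 2"
  proof -
    have "10 * fps_nth F 5 = 2 * d 4 + 2 * fps_nth F 3 * d 2 + 2 * fps_nth F 5"
      using c[of 5] d0 unfolding lhs fps_mult_coeffs odd d_def
      by (simp add: F01 F01(2)[unfolded One_nat_def])
    then have "2 * (4 * fps_nth F 5) = 2 * (d 4 + fps_nth F 3 * d 2)" by algebra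
    then show ?thesis by (simp only: mult_cancel_left zero_neq_numeral) simp
  qed
  ultimately have "4 * fps_nth F 5 = d 4 + (d 2)\<^sup>2 / 2"
    by (simp add: power2_eq_square field_simps)
  then show ?thesis
    unfolding d_def fps_compose_coeffs[OF G0] unfolding A_def b_def W_def F_def \<Phi>_def G_def .
qed

text \<open>An odd function satisfies \<open>f z - f (- z) = 2 f z\<close>, so for the Schwarz function \<open>z\<^sup>4\<close> the defining
  equation reduces to \<open>z f'(z) / f z = \<phi> (z\<^sup>4)\<close>. Its solution is \<open>f z = z exp (I z)\<close> with
  \<open>z I'(z) = \<phi> (z\<^sup>4) - 1\<close>. If \<open>\<Psi>\<close> is a primitive of \<open>(\<phi> v - 1) / v\<close>, then \<open>I z\<close> is
  \<open>(\<Psi> (z\<^sup>4) - \<Psi> 0) / 4\<close>; it is even, and hence \<open>f\<close> is odd.\<close>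

lemma extremal_function:
  assumes hol\<phi>: "\<phi> holomorphic_on unit_disk" and \<phi>0: "\<phi> 0 = 1"
  obtains f where "f \<in> class_A"
    "\<And>z. z \<in> unit_disk \<Longrightarrow> f (- z) = - f z"
    "\<And>z. z \<in> unit_disk \<Longrightarrow> z \<noteq> 0 \<Longrightarrow> f z \<noteq> 0"
    "\<And>z. z \<in> unit_disk \<Longrightarrow> z * deriv f z = f z * \<phi> (z ^ 4)"
proof -
  define \<psi> where "\<psi> = (\<lambda>v. if v = 0 then deriv \<phi> 0 else (\<phi> v - \<phi> 0) / (v - 0))"
  have "\<psi> holomorphic_on unit_disk"
    unfolding \<psi>_def by (rule pole_lemma_open[OF hol\<phi>]) simp
  then obtain \<Psi> where \<Psi>: "\<And>v. v \<in> unit_disk \<Longrightarrow> (\<Psi> has_field_derivative \<psi> v) (at v within unit_disk)"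
    using holomorphic_convex_primitive'[of unit_disk \<psi>] by auto
  have z4: "z ^ 4 \<in> unit_disk" if "z \<in> unit_disk" for z :: complex
    using that by (simp add: norm_power power_less_one_iff)
  define f where "f = (\<lambda>z. z * exp ((\<Psi> (z ^ 4) - \<Psi> 0) / 4))"
  have f': "(f has_field_derivative exp ((\<Psi> (z ^ 4) - \<Psi> 0) / 4) * \<phi> (z ^ 4)) (at z)"
    if z: "z \<in> unit_disk" for z
  proof -
    have "(\<Psi> has_field_derivative \<psi> (z ^ 4)) (at (z ^ 4))"
      using \<Psi>[OF z4[OF z]] z4[OF z] at_within_open[of "z ^ 4" unit_disk] by simp
    then have "((\<lambda>z. \<Psi> (z ^ 4)) has_field_derivative \<psi> (z ^ 4) * (4 * z ^ 3)) (at z)"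
      by (rule DERIV_chain2) (auto intro!: derivative_eq_intros)
    then have "(f has_field_derivative exp ((\<Psi> (z ^ 4) - \<Psi> 0) / 4) * (1 + z ^ 4 * \<psi> (z ^ 4))) (at z)"
      unfolding f_def by (auto intro!: derivative_eq_intros simp: algebra_simps eval_nat_numeral)
    moreover have "1 + z ^ 4 * \<psi> (z ^ 4) = \<phi> (z ^ 4)"
      by (simp add: \<psi>_def \<phi>0)
    ultimately show ?thesis by simp
  qed
  have d: "deriv f z = exp ((\<Psi> (z ^ 4) - \<Psi> 0) / 4) * \<phi> (z ^ 4)" if "z \<in> unit_disk" for z
    using f'[OF that] by (rule DERIV_imp_deriv)
  show ?thesis
  proof
    have "f holomorphic_on unit_disk"
      using f' holomorphic_on_open[OF open_ball] by blast
    then show "f \<in> class_A"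
      using d[of 0] by (simp add: class_A_def \<phi>0 f_def[THEN fun_cong])
  next
    fix z assume z: "z \<in> unit_disk"
    show "z * deriv f z = f z * \<phi> (z ^ 4)" by (simp add: d[OF z]) (simp add: f_def)
  qed (auto simp: f_def)
qed

theorem theorem2p2:
  fixes \<phi> :: "complex \<Rightarrow> complex" and B :: "nat \<Rightarrow> real"
  assumes "ma_minda \<phi>"
    and "\<And>n. fps_nth (fps_expansion \<phi> 0) n = of_real (B n)"
    and "B 1 > 0"
    and "cond_C1 (B 1) (B 2)"
    and "cond_C2 (B 1) (B 2) (B 3)"
    and "cond_C3 (B 1) (B 2) (B 3) (B 4)"
    and "cond_C4 (B 1) (B 2)"
  shows "(\<forall>f\<in>starlike_symmetric \<phi>. cmod (fps_nth (fps_expansion f 0) 5) \<le> B 1 / 4) \<and>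
         (\<exists>f\<in>starlike_symmetric \<phi>. cmod (fps_nth (fps_expansion f 0) 5) = B 1 / 4)"
proof -
  have hol\<phi>: "\<phi> holomorphic_on unit_disk" and \<phi>0: "\<phi> 0 = 1"
    and Re\<phi>: "\<And>z. z \<in> unit_disk \<Longrightarrow> 0 < Re (\<phi> z)"
    using assms(1) by (auto simp: ma_minda_def)
  define t P R S where "t = B 1" and "P = B 2 / B 1" and "R = B 3 / B 1" and "S = B 4 / B 1"
  have t: "t > 0" using assms(3) by (simp add: t_def)
  have B: "B 1 = t" "B 2 = t * P" "B 3 = t * R" "B 4 = t * S"
    using assms(3) by (simp_all add: t_def P_def R_def S_def)
  note b = assms(2)[of 1, unfolded B] assms(2)[of 2, unfolded B] assms(2)[of 3, unfolded B]
    assms(2)[of 4, unfolded B]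
  have bound: "cmod (fps_nth (fps_expansion f 0) 5) \<le> B 1 / 4" if "f \<in> starlike_symmetric \<phi>" for f
  proof -
    from that have A: "f \<in> class_A"
      and "subordinate (\<lambda>z. if z = 0 then 1 else 2 * z * deriv f z / (f z - f (- z))) \<phi>"
      by (auto simp: starlike_symmetric_def)
    then obtain w where w: "schwarz w"
      and sub: "\<And>z. z \<in> unit_disk \<Longrightarrow> 
        (if z = 0 then 1 else 2 * z * deriv f z / (f z - f (- z))) = \<phi> (w z)"
      unfolding subordinate_def schwarz_def by blast
    have eq: "2 * z * deriv f z = (f z - f (- z)) * \<phi> (w z)" if z: "z \<in> unit_disk" for z
    proof (cases "z = 0")
      case False
      have "w z \<in> unit_disk" using w z unfolding schwarz_def by blast
      \<comment> \<open>\<open>\<phi>\<close> omits \<open>0\<close>, so the quotient is not one of the division-by-zero values.\<close>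
      then have "\<phi> (w z) \<noteq> 0" using Re\<phi> by fastforce
      with sub[OF z] False have "f z - f (- z) \<noteq> 0" by auto
      with sub[OF z] False show ?thesis by (simp add: field_simps)
    qed simp
    define W where "W = fps_nth (fps_expansion w 0)"
    define E where "E = W 4 + 2 * P * W 1 * W 3 + (P + t / 2) * (W 2)\<^sup>2
        + (3 * R + t * P) * (W 1)\<^sup>2 * W 2 + (S + t * P\<^sup>2 / 2) * W 1 ^ 4"
    note cond = coefficient_conditions[OF t assms(4-7)[unfolded B]]
    have E: "cmod E \<le> 1"
      unfolding E_def W_def
      by (rule schwarz_quartic_bound[OF w cond(1-4) less_imp_le[OF cond(5)] less_imp_le[OF cond(6)]])
    have "4 * fps_nth (fps_expansion f 0) 5 = t * E"
      by (rule trans[OF fifth_coefficient_formula[OF A hol\<phi> \<phi>0 w eq, unfolded b W_def[symmetric]]])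
         (simp_all add: E_def field_simps power2_eq_square power4_eq_xxxx)
    moreover have "cmod (4 * fps_nth (fps_expansion f 0) 5) = 4 * cmod (fps_nth (fps_expansion f 0) 5)"
      by (simp add: norm_mult)
    ultimately have "4 * cmod (fps_nth (fps_expansion f 0) 5) = t * cmod E"
      using t by (simp add: norm_mult)
    also have "\<dots> \<le> t * 1" using E t by (intro mult_left_mono) auto
    finally show ?thesis by (simp add: t_def)
  qed
  have sharp: "\<exists>f\<in>starlike_symmetric \<phi>. cmod (fps_nth (fps_expansion f 0) 5) = B 1 / 4"
  proof -
    obtain f where A: "f \<in> class_A" and odd: "\<And>z. z \<in> unit_disk \<Longrightarrow> f (- z) = - f z"
      and nz: "\<And>z. z \<in> unit_disk \<Longrightarrow> z \<noteq> 0 \<Longrightarrow> f z \<noteq> 0"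
      and ode: "\<And>z. z \<in> unit_disk \<Longrightarrow> z * deriv f z = f z * \<phi> (z ^ 4)"
      using extremal_function[OF hol\<phi> \<phi>0] by blast
    have w: "schwarz (\<lambda>z. z ^ 4)"
      by (auto simp: schwarz_def norm_power power_less_one_iff intro!: holomorphic_intros)
    have "(if z = 0 then 1 else 2 * z * deriv f z / (f z - f (- z))) = \<phi> (z ^ 4)" if "z \<in> unit_disk" for z
      using odd[OF that] nz[OF that] ode[OF that] by (auto simp: \<phi>0 field_simps)
    then have "f \<in> starlike_symmetric \<phi>"
      using A w unfolding starlike_symmetric_def subordinate_def schwarz_def by blast
    moreover have "4 * fps_nth (fps_expansion f 0) 5 = t"
    proof -
      have W: "fps_expansion (\<lambda>z::complex. z ^ 4) 0 = fps_X ^ 4"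
        by (intro fps_expansion_eqI has_fps_expansion_fps_X_power)
      have "2 * z * deriv f z = (f z - f (- z)) * \<phi> (z ^ 4)" if "z \<in> unit_disk" for z
        using odd[OF that] ode[OF that] by (simp add: mult.assoc)
      from fifth_coefficient_formula[OF A hol\<phi> \<phi>0 w this]
      show ?thesis unfolding b W by (simp add: fps_X_power_nth)
    qed
    then have "fps_nth (fps_expansion f 0) 5 = of_real (t / 4)" by (simp add: field_simps)
    then have "cmod (fps_nth (fps_expansion f 0) 5) = B 1 / 4"
      using t by (simp only: norm_of_real B)
    ultimately show ?thesis by blast
  qed
  show ?thesis using bound sharp by blast
qed

end
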